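(* Let $f:H\to\mathbb{R}$ be convex and twice differentiable, have quadratic growth with constant $\mu>0$, and admit a unique minimizer; let $f^*$ be its minimum value. Pick $m\ge\frac12$ and let $$\alpha\in\left(0,\left(2-\tfrac{\sqrt2}{2}\right)\sqrt{\mu m}\right],\qquad \beta>0,\qquad \gamma=m\left(1+\frac{\alpha\beta}{2+3\sqrt2}\right)+\frac{\alpha\beta}{3+\sqrt2}.$$ Let $x:[0,\infty)\to H$ satisfy $$\ddot{x}(t)+\alpha\dot{x}(t)+\beta\nabla^2 f(x(t))\dot{x}(t)+\gamma\nabla f(x(t))=0$$ with $x(0)=x_0$ and $\dot{x}(0)=v_0$. If $v_0=-\beta\nabla f(x_0)$, then for every $t\ge 0$, $$f(x(t))-f^*\le(1+\sqrt2)\left(f(x_0)-f^*\right)e^{-\frac{2}{3+\sqrt2}\alpha t},$$ and moreover $$\int_0^\infty e^{\frac{2\alpha}{3+\sqrt2}t}\|\nabla f(x(t))\|^2\,dt<\infty.$$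
   Context: $H$ is a real Hilbert space with norm $\|\cdot\|$, and $f^*=\min(f)$. With $S=\operatorname{argmin}(f)$, $f$ has quadratic growth with constant $\mu$ if $f(x)-f^*\ge\frac{\mu}{2}\operatorname{dist}(x,S)^2$ for all $x\in H$. *)

theory Defs
  imports "HOL-Analysis.Analysis"
begin

text \<open>
  A real Hilbert space is a type of sort \<open>{real_inner, complete_space}\<close>.
  On such a space every Frechet derivative of a real-valued function is represented by a unique
  vector (Riesz), so the description below is proper at every point of differentiability.
\<close>

definition gradient :: "('a::real_inner \<Rightarrow> real) \<Rightarrow> 'a \<Rightarrow> 'a"
  where "gradient f x = (THE D. GDERIV f x :> D)"

definition hessian :: "('a::real_inner \<Rightarrow> real) \<Rightarrow> 'a \<Rightarrow> 'a \<Rightarrow> 'a"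
  where "hessian f x = frechet_derivative (gradient f) (at x)"

definition twice_differentiable :: "('a::real_inner \<Rightarrow> real) \<Rightarrow> bool"
  where "twice_differentiable f \<longleftrightarrow>
    (\<forall>x. f differentiable (at x)) \<and> (\<forall>x. gradient f differentiable (at x))"

definition minimizers :: "('a \<Rightarrow> real) \<Rightarrow> 'a set"
  where "minimizers f = {x. is_arg_min f (\<lambda>_. True) x}"

text \<open>
  The least element of the range; specified only if the minimum is attained.
\<close>

definition min_value :: "('a \<Rightarrow> real) \<Rightarrow> real"
  where "min_value f = (LEAST c. c \<in> range f)"

definition quadratic_growth :: "('a::real_inner \<Rightarrow> real) \<Rightarrow> real \<Rightarrow> bool"
  where "quadratic_growth f \<mu> \<longleftrightarrow>
    (\<forall>x. f x - min_value f \<ge> \<mu> / 2 * (infdist x (minimizers f))\<^sup>2)"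

end

theory Submission
  imports Defs
begin

text \<open>
  Let \<open>z\<close> be the minimizer, \<open>e = x - z\<close>, \<open>g = \<nabla>f(x)\<close> and \<open>v = x' + \<beta> g\<close>. In these variables the Hessian
  disappears: \<open>x' = v - \<beta> g\<close> and \<open>v' = (\<alpha>\<beta> - \<gamma>) g - \<alpha> v\<close>, with \<open>v(0) = 0\<close>. Put
  \<open>\<delta> = 2\<alpha> / (3 + \<surd>2)\<close>, \<open>l = \<alpha> - \<delta>/2\<close> and \<open>G = \<gamma> - \<delta>\<beta>/2\<close>. For the Lyapunov function
  \<open>E = G (f(x) - f(z)) + |l e + v|\<^sup>2 / 2 - (l\<delta>/4) |e|\<^sup>2\<close>
  all terms containing \<open>v\<close> cancel in \<open>E' + \<delta>E\<close>. Convexity and quadratic growth then give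
  \<open>E' + \<delta>E \<le> - c |g|\<^sup>2\<close> with \<open>c > 0\<close>, which yields both the decay of \<open>E\<close> and the weighted
  integrability of \<open>|g|\<^sup>2\<close>. Quadratic growth moreover shows \<open>E \<ge> (\<surd>2/2) G (f(x) - f(z))\<close> at all
  times and \<open>E(0) \<le> (1 + \<surd>2/2) G (f(x(0)) - f(z))\<close>; the quotient of the two constants is \<open>1 + \<surd>2\<close>.
\<close>

section \<open>Riesz representation, gradients and the tangent inequality of convex
  functions\<close>

lemma riesz_representation:
  fixes \<phi> :: "'a::{real_inner, complete_space} \<Rightarrow> real"
  assumes "bounded_linear \<phi>"
  shows "\<exists>u. \<forall>h. \<phi> h = h \<bullet> u"
proof -
  interpret \<phi>: bounded_linear \<phi> by fact
  \<comment> \<open>The representing vector is the minimizer of \<open>|z|\<^sup>2/2 - \<phi>(z)\<close>; by the parallelogram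
    identity every minimizing sequence is Cauchy.\<close>
  define q where "q = (\<lambda>z. z \<bullet> z / 2 - \<phi> z)"
  obtain K where K: "\<bar>\<phi> z\<bar> \<le> norm z * K" for z
    using \<phi>.bounded by auto
  have "q z \<ge> - (K\<^sup>2 / 2)" for z
  proof -
    have "\<phi> z \<le> norm z * K"
      using K[of z] by linarith
    moreover have "norm z * K \<le> (norm z)\<^sup>2 / 2 + K\<^sup>2 / 2"
      using zero_le_power2[of "norm z - K"] by (simp add: power2_diff algebra_simps)
    ultimately show ?thesis
      by (simp add: q_def power2_norm_eq_inner)
  qed
  then have bdd: "bdd_below (range q)"
    by (intro bdd_belowI2)
  define I where "I = Inf (range q)"
  have I_le: "I \<le> q z" for z
    unfolding I_def by (rule cInf_lower[OF _ bdd]) simp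
  have "\<exists>z. q z < I + 1 / real (Suc n)" for n
    using cInf_lessD[of "range q" "I + 1 / real (Suc n)"] by (auto simp: I_def)
  then obtain w where w: "q (w n) < I + 1 / real (Suc n)" for n
    by metis
  have parallelogram: "(norm (a - b))\<^sup>2 \<le> 4 * q a + 4 * q b - 8 * I" for a b
  proof -
    \<comment> \<open>At the midpoint the linear part of \<open>q\<close> cancels, leaving only the
      parallelogram defect; the bound follows from \<open>I \<le> q c\<close>.\<close>
    define c where "c = (1/2) *\<^sub>R (a + b)"
    have "q a + q b - 2 * q c = (norm (a - b))\<^sup>2 / 4"
      by (simp add: q_def c_def power2_norm_eq_inner \<phi>.add \<phi>.scaleR inner_add inner_diff
          inner_commute algebra_simps)
    then show ?thesis
      using I_le[of c] by linarith
  qed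
  have "Cauchy w"
  proof (rule metric_CauchyI)
    fix e :: real assume "e > 0"
    \<comment> \<open>The threshold \<open>e\<^sup>2 / 8\<close> is what
      \<open>parallelogram\<close> asks for: two excesses below it, each weighted by 4, add up to
      less than \<open>e\<^sup>2\<close>.\<close>
    obtain N where "8 / e\<^sup>2 < real N"
      using reals_Archimedean2 by blast
    then have "8 / e\<^sup>2 < real (Suc N)"
      by simp
    then have small: "1 / real (Suc N) < e\<^sup>2 / 8"
      using \<open>e > 0\<close> by (simp add: field_simps)
    have near: "q (w k) - I < e\<^sup>2 / 8" if "k \<ge> N" for k
    proof -
      have "1 / real (Suc k) \<le> 1 / real (Suc N)"
        using that by (intro divide_left_mono) auto
      with w[of k] small show ?thesis by linarith
    qed
    have "dist (w i) (w j) < e" if "i \<ge> N" "j \<ge> N" for i j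
    proof -
      have "(norm (w i - w j))\<^sup>2 < e\<^sup>2"
        using parallelogram[of "w i" "w j"] near[OF that(1)] near[OF that(2)] by linarith
      then have "norm (w i - w j) < e"
        by (rule power2_less_imp_less) (use \<open>e > 0\<close> in simp)
      then show ?thesis
        by (simp only: dist_norm)
    qed
    then show "\<exists>M. \<forall>i\<ge>M. \<forall>j\<ge>M. dist (w i) (w j) < e" by blast
  qed
  then obtain u where u: "w \<longlonglongrightarrow> u"
    using Cauchy_convergent convergent_def by blast
  have "(\<lambda>n. q (w n)) \<longlonglongrightarrow> q u"
    unfolding q_def by (intro tendsto_intros u \<phi>.tendsto) simp
  moreover have "(\<lambda>n. I + 1 / real (Suc n)) \<longlonglongrightarrow> I + 0"
    by (intro tendsto_intros LIMSEQ_Suc[OF lim_1_over_n])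
  ultimately have "q u \<le> I + 0"
    by (rule LIMSEQ_le) (use w less_imp_le in blast)
  then have q_u: "q u \<le> q z" for z
    using I_le[of z] by linarith
  have "\<phi> h = h \<bullet> u" for h
  proof (cases "h = 0")
    case False
    \<comment> \<open>This \<open>c\<close> minimizes the quadratic polynomial s \<mapsto>
      \<open>q (u - s *\<^sub>R h)\<close>. Since \<open>u\<close> already minimizes
      \<open>q\<close>, the resulting decrease has to vanish.\<close>
    define c where "c = (h \<bullet> u - \<phi> h) / (h \<bullet> h)"
    have hh: "h \<bullet> h > 0" using False by simp
    have "q (u - c *\<^sub>R h) - q u = c\<^sup>2 * (h \<bullet> h) / 2 - c * (h \<bullet> u - \<phi> h)"
      by (simp add: q_def \<phi>.diff \<phi>.scaleR inner_diff inner_commute power2_eq_square field_simps)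
    also have "\<dots> = - ((h \<bullet> u - \<phi> h)\<^sup>2 / (2 * (h \<bullet> h)))"
      using hh by (simp add: c_def power2_eq_square field_simps)
    finally have "(h \<bullet> u - \<phi> h)\<^sup>2 / (2 * (h \<bullet> h)) \<le> 0"
      using q_u[of "u - c *\<^sub>R h"] by linarith
    then show ?thesis
      using hh by (simp add: divide_le_0_iff)
  qed simp
  then show ?thesis by blast
qed

text \<open>Makes the definite description in \<open>gradient\<close> usable: Riesz gives existence,
  while uniqueness of the Frechet derivative and nondegeneracy of the inner product give
  uniqueness.\<close>

lemma gderiv_gradient:
  fixes f :: "'a::{real_inner, complete_space} \<Rightarrow> real"
  assumes "f differentiable (at z)"
  shows "GDERIV f z :> gradient f z"
proof -
  obtain D where D: "(f has_derivative D) (at z)"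
    using assms by (auto simp: differentiable_def)
  obtain u where "\<And>h. D h = h \<bullet> u"
    using riesz_representation[OF has_derivative_bounded_linear[OF D]] by blast
  then have "D = (\<lambda>h. h \<bullet> u)"
    by blast
  with D have u: "GDERIV f z :> u"
    by (simp add: gderiv_def)
  have "v = u" if "GDERIV f z :> v" for v
  proof -
    have "(\<lambda>h. h \<bullet> v) = (\<lambda>h. h \<bullet> u)"
      using that u unfolding gderiv_def by (rule has_derivative_unique)
    then show ?thesis
      using vector_eq_ldot by metis
  qed
  with u show ?thesis
    unfolding gradient_def by (rule theI)
qed

lemma has_real_derivative_gderiv_comp:
  assumes "GDERIV f (c t) :> g" and "(c has_vector_derivative c') (at t within S)"
  shows "((\<lambda>s. f (c s)) has_real_derivative c' \<bullet> g) (at t within S)"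
proof -
  have "(f has_derivative (\<lambda>h. h \<bullet> g)) (at (c t) within c ` S)"
    using assms(1) by (auto simp: gderiv_def intro: has_derivative_at_withinI)
  from vector_derivative_diff_chain_within[OF assms(2) this] show ?thesis
    by (simp add: o_def has_real_derivative_iff_has_vector_derivative)
qed

text \<open>Restricting \<open>f\<close> to the line through \<open>z\<close> and \<open>y\<close>
  reduces the claim to the tangent inequality for a convex function of one real variable, compared
  at 0 and 1.\<close>

lemma convex_on_gradient_le:
  fixes f :: "'a::real_inner \<Rightarrow> real"
  assumes "convex_on UNIV f" and "GDERIV f z :> g"
  shows "(y - z) \<bullet> g \<le> f y - f z"
proof -
  define \<psi> where "\<psi> = (\<lambda>s::real. f (z + s *\<^sub>R (y - z)))"
  have "convex_on UNIV \<psi>"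
  proof (rule convex_onI)
    fix t r s :: real assume t: "0 < t" "t < 1"
    have "z + ((1 - t) *\<^sub>R r + t *\<^sub>R s) *\<^sub>R (y - z)
        = (1 - t) *\<^sub>R (z + r *\<^sub>R (y - z)) + t *\<^sub>R (z + s *\<^sub>R (y - z))"
      by (simp add: algebra_simps)
    then show "\<psi> ((1 - t) *\<^sub>R r + t *\<^sub>R s) \<le> (1 - t) * \<psi> r + t * \<psi> s"
      unfolding \<psi>_def using convex_onD[OF assms(1), of t] t by simp
  qed simp
  moreover have "(\<psi> has_field_derivative (y - z) \<bullet> g) (at 0)"
  proof -
    have "((\<lambda>s. z + s *\<^sub>R (y - z)) has_vector_derivative (y - z)) (at 0)"
      by (auto intro!: derivative_eq_intros)
    with assms(2) show ?thesis
      unfolding \<psi>_def by (intro has_real_derivative_gderiv_comp) simp_all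
  qed
  ultimately have "\<psi> 1 - \<psi> 0 \<ge> ((y - z) \<bullet> g) * (1 - 0)"
    by (intro convex_on_imp_above_tangent[where A = UNIV]) auto
  then show ?thesis
    by (simp add: \<psi>_def)
qed

section \<open>Integrability on a half-line\<close>

text \<open>The integrals up to \<open>T\<close> are monotone and bounded, so they converge to an
  improper integral; nonnegativity makes it absolutely convergent.\<close>

lemma set_integrable_lborel_atLeast_bounded:
  fixes h :: "real \<Rightarrow> real"
  assumes cont: "continuous_on {a..} h" and nonneg: "\<And>t. t \<ge> a \<Longrightarrow> h t \<ge> 0"
    and bound: "\<And>T. T \<ge> a \<Longrightarrow> integral {a..T} h \<le> B"
  shows "set_integrable lborel {a..} h"
proof -
  have int: "h integrable_on {a..T}" for T
    by (rule integrable_continuous_interval) (rule continuous_on_subset[OF cont], auto)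
  let ?J = "\<lambda>T. integral {a..T} h"
  have mono: "?J S \<le> ?J T" if "S \<le> T" for S T
    by (rule integral_subset_le) (use that int nonneg in auto)
  \<comment> \<open>For \<open>T\<close> < \<open>a\<close> the interval is empty and
    \<open>bound\<close> says nothing; monotonicity passes to \<open>max a T\<close>.\<close>
  have "?J T \<le> B" for T
    using bound[of "max a T"] mono[of T "max a T"] by simp
  then have bdd: "bdd_above (range ?J)"
    by (intro bdd_aboveI2)
  have "(?J \<longlongrightarrow> (SUP T. ?J T)) at_top"
  proof (rule increasing_tendsto)
    show "\<forall>\<^sub>F T in at_top. ?J T \<le> (SUP T. ?J T)"
      by (intro always_eventually allI cSUP_upper bdd) simp
    fix y assume "y < (SUP T. ?J T)"
    then obtain S where "y < ?J S"
      using less_cSUP_iff[OF _ bdd] by auto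
    then show "\<forall>\<^sub>F T in at_top. y < ?J T"
      unfolding eventually_at_top_linorder using mono less_le_trans by blast
  qed
  then have "(h has_integral (SUP T. ?J T)) {a..}"
    by (intro has_integral_to_inf int nonneg)
  then have "h absolutely_integrable_on {a..}"
    by (intro nonnegative_absolutely_integrable_1) (auto simp: nonneg has_integral_integrable)
  \<comment> \<open>Absolute integrability refers to the completed measure; Borel measurability
    carries it back to \<open>lborel\<close>.\<close>
  moreover have "(\<lambda>t. indicator {a..} t *\<^sub>R h t) \<in> borel_measurable borel"
    by (intro borel_measurable_continuous_on_indicator cont) simp
  ultimately show ?thesis
    unfolding set_integrable_def by (simp add: integrable_completion)
qed

section \<open>Derivative of the Lyapunov function\<close>

lemma has_real_derivative_norm_power2:
  fixes c :: "real \<Rightarrow> 'a::real_inner"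
  assumes "(c has_vector_derivative c') (at t within S)"
  shows "((\<lambda>s. (norm (c s))\<^sup>2) has_real_derivative 2 * (c t \<bullet> c')) (at t within S)"
proof -
  have "((\<lambda>s. c s \<bullet> c s) has_derivative (\<lambda>h. c t \<bullet> (h *\<^sub>R c') + (h *\<^sub>R c') \<bullet> c t)) (at t within S)"
    using assms unfolding has_vector_derivative_def by (intro has_derivative_inner)
  then show ?thesis
    by (simp add: power2_norm_eq_inner has_field_derivative_def inner_commute mult_commute_abs
        mult.left_commute)
qed

text \<open>The choices of \<open>l\<close> and \<open>G\<close> give w' = -(\<delta>/2) v - G g for
  w = l e + v. In E' + \<delta>E the |v|^2 terms cancel because of the factor \<delta>/2, the v
  \<bullet> g terms because \<open>G\<close> also weights \<open>\<phi>\<close>, and the e \<bullet>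
  v terms because of the weight \<open>l * \<delta> / 4\<close>.\<close>

lemma lyapunov_has_derivative:
  fixes x v :: "real \<Rightarrow> 'a::real_inner"
  assumes x: "(x has_vector_derivative v t - \<beta> *\<^sub>R g) (at t within S)"
    and v: "(v has_vector_derivative (\<alpha> * \<beta> - \<gamma>) *\<^sub>R g - \<alpha> *\<^sub>R v t) (at t within S)"
    and \<phi>: "(\<phi> has_real_derivative (v t - \<beta> *\<^sub>R g) \<bullet> g) (at t within S)"
    and l: "l = \<alpha> - \<delta> / 2" and G: "G = \<gamma> - \<delta> * \<beta> / 2"
    and E: "E = (\<lambda>s. G * \<phi> s + (norm (l *\<^sub>R (x s - z) + v s))\<^sup>2 / 2
               - l * \<delta> / 4 * (norm (x s - z))\<^sup>2)"
  shows "(E has_real_derivative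
      (\<delta> * G * \<phi> t - l * (G - \<delta> * \<beta> / 2) * ((x t - z) \<bullet> g)
        + \<delta> * l * (l - \<delta> / 2) / 2 * (norm (x t - z))\<^sup>2 - G * \<beta> * (norm g)\<^sup>2) - \<delta> * E t)
    (at t within S)"
proof -
  define e where "e = x t - z"
  let ?x' = "v t - \<beta> *\<^sub>R g"
  have xz: "((\<lambda>s. x s - z) has_vector_derivative ?x') (at t within S)"
    using has_vector_derivative_diff[OF x has_vector_derivative_const] by simp
  have "l *\<^sub>R ?x' + ((\<alpha> * \<beta> - \<gamma>) *\<^sub>R g - \<alpha> *\<^sub>R v t) = - ((\<delta> / 2) *\<^sub>R v t) - G *\<^sub>R g"
    by (simp add: l G algebra_simps)
  moreover have "((\<lambda>s. l *\<^sub>R (x s - z) + v s) has_vector_derivative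
      l *\<^sub>R ?x' + ((\<alpha> * \<beta> - \<gamma>) *\<^sub>R g - \<alpha> *\<^sub>R v t)) (at t within S)"
    by (intro has_vector_derivative_add v xz
        bounded_linear.has_vector_derivative[OF bounded_linear_scaleR_right])
  ultimately have w: "((\<lambda>s. l *\<^sub>R (x s - z) + v s) has_vector_derivative
      - ((\<delta> / 2) *\<^sub>R v t) - G *\<^sub>R g) (at t within S)"
    by simp
  have "(E has_real_derivative G * (?x' \<bullet> g)
      + 2 * ((l *\<^sub>R e + v t) \<bullet> (- ((\<delta> / 2) *\<^sub>R v t) - G *\<^sub>R g)) / 2
      - l * \<delta> / 4 * (2 * (e \<bullet> ?x'))) (at t within S)"
    unfolding E e_def
    by (intro DERIV_diff DERIV_add DERIV_cmult DERIV_cdivide \<phi> has_real_derivative_norm_power2 xz w)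
  moreover have "G * (?x' \<bullet> g) + 2 * ((l *\<^sub>R e + v t) \<bullet> (- ((\<delta> / 2) *\<^sub>R v t) - G *\<^sub>R g)) / 2
      - l * \<delta> / 4 * (2 * (e \<bullet> ?x'))
    = (\<delta> * G * \<phi> t - l * (G - \<delta> * \<beta> / 2) * (e \<bullet> g)
        + \<delta> * l * (l - \<delta> / 2) / 2 * (norm e)\<^sup>2 - G * \<beta> * (norm g)\<^sup>2) - \<delta> * E t"
    unfolding E e_def[symmetric] power2_norm_eq_inner
    unfolding inner_add_left inner_add_right inner_diff_left inner_diff_right
      inner_scaleR_left inner_scaleR_right inner_minus_right
      inner_commute[of g e] inner_commute[of "v t" e] inner_commute[of g "v t"]
    by (simp add: field_simps)
  ultimately show ?thesis
    by (simp only: e_def)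
qed

section \<open>Constants and the dissipation estimate\<close>

text \<open>Both left sides are multiples of \<open>\<delta>\<^sup>2\<close>, and 6 - 4
  \<open>sqrt 2\<close> = (2 - \<open>sqrt 2\<close>)^2. The first product controls the negative
  |e|^2 term of E and the Hessian damping term, the second the |e|^2 term of E' + \<delta>E and the
  value of E when v = 0.\<close>

lemma rate_constants:
  assumes l: "l = \<delta> * (1 + sqrt 2 / 2)"
    and rate: "\<delta>\<^sup>2 \<le> (6 - 4 * sqrt 2) * (m * \<mu>)"
  shows "l * \<delta> \<le> (2 - sqrt 2) * m * \<mu>"
    and "l * (l - \<delta> / 2) \<le> sqrt 2 / 2 * m * \<mu>"
proof -
  have s: "sqrt 2 * sqrt 2 = 2" "sqrt 2 > 1"
    by (simp_all add: real_less_rsqrt)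
  show "l * \<delta> \<le> (2 - sqrt 2) * m * \<mu>"
  proof -
    have "l * \<delta> = (1 + sqrt 2 / 2) * \<delta>\<^sup>2"
      by (simp add: l power2_eq_square)
    also have "\<dots> \<le> (1 + sqrt 2 / 2) * ((6 - 4 * sqrt 2) * (m * \<mu>))"
      using rate s by (intro mult_left_mono) auto
    also have "\<dots> = ((1 + sqrt 2 / 2) * (6 - 4 * sqrt 2)) * m * \<mu>"
      by simp
    also have "(1 + sqrt 2 / 2) * (6 - 4 * sqrt 2) = 2 - sqrt 2"
      using s(1) by (simp add: algebra_simps)
    finally show ?thesis .
  qed
  show "l * (l - \<delta> / 2) \<le> sqrt 2 / 2 * m * \<mu>"
  proof -
    have "l * (l - \<delta> / 2) = ((1 + sqrt 2 / 2) * (1 / 2 + sqrt 2 / 2)) * \<delta>\<^sup>2"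
      by (simp add: l power2_eq_square field_simps)
    also have "\<dots> \<le> ((1 + sqrt 2 / 2) * (1 / 2 + sqrt 2 / 2)) * ((6 - 4 * sqrt 2) * (m * \<mu>))"
      using rate s by (intro mult_left_mono) auto
    also have "\<dots> = ((1 + sqrt 2 / 2) * (1 / 2 + sqrt 2 / 2) * (6 - 4 * sqrt 2)) * m * \<mu>"
      by simp
    also have "(1 + sqrt 2 / 2) * (1 / 2 + sqrt 2 / 2) * (6 - 4 * sqrt 2) = sqrt 2 / 2"
      using s(1) by (simp add: algebra_simps)
    finally show ?thesis .
  qed
qed

text \<open>
  The term \<open>l\<delta>\<beta>/2 * (e \<bullet> g)\<close> caused by the Hessian damping has the unfavourable sign. Since convexity and
  quadratic growth give \<open>|e| \<le> (2/\<mu>) |g|\<close>, it is absorbed by \<open>G\<beta> |g|\<^sup>2\<close>, with a positive remainder.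
\<close>

lemma lyapunov_dissipation:
  fixes e g :: "'a::real_inner"
  assumes "\<mu> > 0" "\<beta> > 0" "\<delta> > 0" "m > 0" "G \<ge> m"
    and l: "l = \<delta> * (1 + sqrt 2 / 2)"
    and rate: "\<delta>\<^sup>2 \<le> (6 - 4 * sqrt 2) * (m * \<mu>)"
    and tangent: "p \<le> e \<bullet> g"
    and growth: "\<mu> / 2 * (norm e)\<^sup>2 \<le> p"
  shows "\<delta> * G * p - l * (G - \<delta> * \<beta> / 2) * (e \<bullet> g)
        + \<delta> * l * (l - \<delta> / 2) / 2 * (norm e)\<^sup>2 - G * \<beta> * (norm g)\<^sup>2
    \<le> - ((sqrt 2 - 1) * m * \<beta> * (norm g)\<^sup>2)"
proof -
  have s: "sqrt 2 * sqrt 2 = 2" "sqrt 2 > 1"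
    by (simp_all add: real_less_rsqrt)
  have l_pos: "l > 0"
    using assms s by (simp add: add_pos_pos)
  have inner_le: "e \<bullet> g \<le> norm e * norm g"
    by (rule norm_cauchy_schwarz)
  \<comment> \<open>Growth, the tangent inequality and Cauchy-Schwarz bound (\<mu>/2) |e|^2 by |g|
    |e|; then |e| is divided out.\<close>
  have "\<mu> / 2 * norm e \<le> norm g"
  proof (cases "e = 0")
    case False
    have "(\<mu> / 2 * norm e) * norm e \<le> norm g * norm e"
      using order_trans[OF growth order_trans[OF tangent inner_le]]
      by (simp add: power2_eq_square mult_ac)
    then show ?thesis
      using False by (simp only: mult_le_cancel_right) auto
  qed simp
  then have "norm e \<le> 2 / \<mu> * norm g"
    using \<open>\<mu> > 0\<close> by (simp add: field_simps)
  then have "norm e * norm g \<le> 2 / \<mu> * (norm g)\<^sup>2"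
    using mult_right_mono[of "norm e" "2 / \<mu> * norm g" "norm g"] by (simp add: power2_eq_square)
  with inner_le have inner_le_gg: "e \<bullet> g \<le> 2 / \<mu> * (norm g)\<^sup>2"
    by linarith
  note l_delta = rate_constants(1)[OF l rate] and l_sq = rate_constants(2)[OF l rate]
  have "G > 0"
    using \<open>m > 0\<close> \<open>G \<ge> m\<close> by simp
  have "l * G * p \<le> l * G * (e \<bullet> g)"
    by (rule mult_left_mono[OF tangent]) (use l_pos \<open>G > 0\<close> in simp)
  moreover have "l * (\<delta> * \<beta> / 2) * (e \<bullet> g) \<le> (2 - sqrt 2) * m * \<beta> * (norm g)\<^sup>2"
  proof -
    have "l * (\<delta> * \<beta> / 2) * (e \<bullet> g) \<le> l * (\<delta> * \<beta> / 2) * (2 / \<mu> * (norm g)\<^sup>2)"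
      by (rule mult_left_mono[OF inner_le_gg]) (use l_pos \<open>\<delta> > 0\<close> \<open>\<beta> > 0\<close> in simp)
    also have "\<dots> = (l * \<delta>) * (\<beta> / \<mu> * (norm g)\<^sup>2)"
      by simp
    also have "\<dots> \<le> ((2 - sqrt 2) * m * \<mu>) * (\<beta> / \<mu> * (norm g)\<^sup>2)"
      by (rule mult_right_mono[OF l_delta]) (use \<open>\<beta> > 0\<close> \<open>\<mu> > 0\<close> in simp)
    finally show ?thesis
      using \<open>\<mu> > 0\<close> by simp
  qed
  moreover have "\<delta> * l * (l - \<delta> / 2) / 2 * (norm e)\<^sup>2 \<le> \<delta> * (sqrt 2 / 2) * G * p"
  proof -
    have "\<delta> * l * (l - \<delta> / 2) / 2 * (norm e)\<^sup>2 = (l * (l - \<delta> / 2)) * (\<delta> / 2 * (norm e)\<^sup>2)"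
      by simp
    also have "\<dots> \<le> (sqrt 2 / 2 * m * \<mu>) * (\<delta> / 2 * (norm e)\<^sup>2)"
      by (rule mult_right_mono[OF l_sq]) (use \<open>\<delta> > 0\<close> in simp)
    also have "\<dots> = (\<delta> * (sqrt 2 / 2) * m) * (\<mu> / 2 * (norm e)\<^sup>2)"
      by simp
    also have "\<dots> \<le> (\<delta> * (sqrt 2 / 2) * G) * p"
      by (rule mult_mono[OF mult_left_mono[OF \<open>G \<ge> m\<close>] growth])
        (use \<open>\<delta> > 0\<close> \<open>\<mu> > 0\<close> \<open>G > 0\<close> in simp_all)
    finally show ?thesis .
  qed
  \<comment> \<open>Splitting \<open>l\<close> divides the gain from e \<bullet> g into two shares:
    one cancels \<open>\<delta> * G * p\<close>, the other pays for the |e|^2 term just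
    estimated.\<close>
  moreover have "l * G * p = \<delta> * G * p + \<delta> * (sqrt 2 / 2) * G * p"
    by (simp add: l algebra_simps)
  moreover have "m * \<beta> * (norm g)\<^sup>2 \<le> G * \<beta> * (norm g)\<^sup>2"
    by (intro mult_right_mono \<open>G \<ge> m\<close>) (use \<open>\<beta> > 0\<close> in simp_all)
  moreover have "l * (G - \<delta> * \<beta> / 2) * (e \<bullet> g) = l * G * (e \<bullet> g) - l * (\<delta> * \<beta> / 2) * (e \<bullet> g)"
    by (simp add: right_diff_distrib left_diff_distrib)
  \<comment> \<open>The remainder: of the available m \<beta> |g|^2, the Hessian damping term
    consumes the fraction 2 - \<open>sqrt 2\<close> < 1.\<close>
  moreover have "(sqrt 2 - 1) * m * \<beta> * (norm g)\<^sup>2 = m * \<beta> * (norm g)\<^sup>2 - (2 - sqrt 2) * m * \<beta> * (norm g)\<^sup>2"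
    by (simp add: algebra_simps)
  ultimately show ?thesis
    by linarith
qed

section \<open>From the differential inequality to decay and integrability\<close>

text \<open>Gronwall with the integrating factor \<open>exp (\<delta> * t)\<close>: the derivative
  of \<open>exp (\<delta> * t) * E t\<close> is \<open>exp (\<delta> * t) * D t\<close>. Keeping the
  integral of \<open>h\<close> instead of discarding it is what later gives integrability.\<close>

lemma exp_weighted_decay:
  fixes E h :: "real \<Rightarrow> real"
  assumes deriv: "\<And>t. t \<ge> 0 \<Longrightarrow> (E has_real_derivative D t - \<delta> * E t) (at t within {0..})"
    and le: "\<And>t. t \<ge> 0 \<Longrightarrow> D t \<le> - h t"
    and cont: "continuous_on {0..} h"
    and "T \<ge> 0"
  shows "exp (\<delta> * T) * E T + integral {0..T} (\<lambda>t. exp (\<delta> * t) * h t) \<le> E 0"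
proof -
  have "((\<lambda>t. exp (\<delta> * t) * E t) has_vector_derivative exp (\<delta> * t) * D t) (at t within {0..T})"
    if "t \<in> {0..T}" for t
  proof -
    have "(E has_real_derivative D t - \<delta> * E t) (at t within {0..T})"
      using deriv[of t] that by (auto intro: DERIV_subset)
    then show ?thesis
      unfolding has_real_derivative_iff_has_vector_derivative[symmetric]
      by (auto intro!: derivative_eq_intros simp: algebra_simps)
  qed
  \<comment> \<open>\<open>D\<close> is not assumed continuous; the gauge integral of a derivative
    exists regardless.\<close>
  from fundamental_theorem_of_calculus[OF \<open>T \<ge> 0\<close> this]
  have "((\<lambda>t. exp (\<delta> * t) * D t) has_integral exp (\<delta> * T) * E T - E 0) {0..T}"
    by simp
  from has_integral_neg[OF this]
  have neg: "((\<lambda>t. exp (\<delta> * t) * (- D t)) has_integral E 0 - exp (\<delta> * T) * E T) {0..T}"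
    by simp
  have "(\<lambda>t. exp (\<delta> * t) * h t) integrable_on {0..T}"
    by (intro integrable_continuous_interval continuous_intros continuous_on_subset[OF cont]) auto
  then have "integral {0..T} (\<lambda>t. exp (\<delta> * t) * h t) \<le> E 0 - exp (\<delta> * T) * E T"
  proof (rule has_integral_le[OF integrable_integral neg])
    fix t assume "t \<in> {0..T}"
    then have "h t \<le> - D t"
      using le[of t] by simp
    then show "exp (\<delta> * t) * h t \<le> exp (\<delta> * t) * (- D t)"
      by (rule mult_left_mono) simp
  qed
  then show ?thesis
    by simp
qed

text \<open>Both terms on the left of \<open>decay\<close> are nonnegative. Dropping the integral
  gives the pointwise rate; dropping the term with \<open>E\<close> bounds the integrals uniformly
  in \<open>T\<close>.\<close>

lemma exp_decay_of_weighted_bound: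
  fixes E h p :: "real \<Rightarrow> real"
  assumes decay: "\<And>T. T \<ge> 0 \<Longrightarrow>
      exp (\<delta> * T) * E T + integral {0..T} (\<lambda>t. exp (\<delta> * t) * h t) \<le> E 0"
    and cont: "continuous_on {0..} h"
    and h: "\<And>t. h t \<ge> 0"
    and "a > 0"
    and p: "\<And>t. p t \<ge> 0"
    and lower: "\<And>t. a * p t \<le> E t"
    and upper: "E 0 \<le> a * (b * p 0)"
  shows "\<And>t. t \<ge> 0 \<Longrightarrow> p t \<le> b * p 0 * exp (- (\<delta> * t))"
    and "set_integrable lborel {0..} (\<lambda>t. exp (\<delta> * t) * h t)"
proof -
  have cont': "continuous_on {0..} (\<lambda>t. exp (\<delta> * t) * h t)"
    by (intro continuous_intros cont)
  have nonneg: "exp (\<delta> * t) * h t \<ge> 0" for t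
    using h[of t] by simp
  have E_nonneg: "E t \<ge> 0" for t
    by (rule order_trans[OF _ lower]) (use p[of t] \<open>a > 0\<close> in simp)
  show "p t \<le> b * p 0 * exp (- (\<delta> * t))" if "t \<ge> 0" for t
  proof -
    have "integral {0..t} (\<lambda>t. exp (\<delta> * t) * h t) \<ge> 0"
      by (intro Henstock_Kurzweil_Integration.integral_nonneg integrable_continuous_interval
          continuous_on_subset[OF cont'] nonneg) auto
    with decay[OF that] upper have "exp (\<delta> * t) * E t \<le> a * (b * p 0)"
      by linarith
    moreover have "exp (\<delta> * t) * (a * p t) \<le> exp (\<delta> * t) * E t"
      by (rule mult_left_mono[OF lower]) simp
    ultimately have "exp (\<delta> * t) * (a * p t) \<le> a * (b * p 0)"
      by linarith
    then have "a * (exp (\<delta> * t) * p t) \<le> a * (b * p 0)"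
      by (simp only: mult.left_commute[of _ a])
    then have "exp (\<delta> * t) * p t \<le> b * p 0"
      using \<open>a > 0\<close> by (rule mult_left_le_imp_le)
    then show ?thesis
      by (simp add: exp_minus field_simps)
  qed
  show "set_integrable lborel {0..} (\<lambda>t. exp (\<delta> * t) * h t)"
  proof (rule set_integrable_lborel_atLeast_bounded[OF cont' nonneg])
    show "integral {0..T} (\<lambda>t. exp (\<delta> * t) * h t) \<le> E 0" if "T \<ge> 0" for T
      using decay[OF that] mult_nonneg_nonneg[OF _ E_nonneg[of T], of "exp (\<delta> * T)"] by simp
  qed
qed

section \<open>Comparison of the Lyapunov function with the function gap, and the parameters\<close>

text \<open>The lower bound discards the square and absorbs the negative |e|^2 term by growth. The
  upper bound is for the initial time, where v = 0 and the quadratic part collapses to l (l -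
  \<delta>/2) |e|^2 / 2.\<close>

lemma lyapunov_bounds:
  fixes e v :: "'a::real_inner"
  assumes "\<mu> > 0" "m > 0" "G \<ge> m"
    and l: "l = \<delta> * (1 + sqrt 2 / 2)"
    and rate: "\<delta>\<^sup>2 \<le> (6 - 4 * sqrt 2) * (m * \<mu>)"
    and growth: "\<mu> / 2 * (norm e)\<^sup>2 \<le> p"
  shows "sqrt 2 / 2 * G * p \<le> G * p + (norm (l *\<^sub>R e + v))\<^sup>2 / 2 - l * \<delta> / 4 * (norm e)\<^sup>2"
    and "G * p + (norm (l *\<^sub>R e))\<^sup>2 / 2 - l * \<delta> / 4 * (norm e)\<^sup>2 \<le> (1 + sqrt 2 / 2) * G * p"
proof -
  have s: "sqrt 2 \<le> 2"
    by (simp add: real_le_lsqrt)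
  show "sqrt 2 / 2 * G * p \<le> G * p + (norm (l *\<^sub>R e + v))\<^sup>2 / 2 - l * \<delta> / 4 * (norm e)\<^sup>2"
  proof -
    have "l * \<delta> / 4 * (norm e)\<^sup>2 \<le> (1 - sqrt 2 / 2) * m * (\<mu> / 2 * (norm e)\<^sup>2)"
      using mult_right_mono[OF rate_constants(1)[OF l rate], of "(norm e)\<^sup>2 / 4"]
      by (simp add: algebra_simps)
    also have "\<dots> \<le> (1 - sqrt 2 / 2) * G * p"
      by (rule mult_mono[OF mult_left_mono[OF \<open>G \<ge> m\<close>] growth]) (use assms(1-3) s in simp_all)
    also have "\<dots> = G * p - sqrt 2 / 2 * G * p"
      by (simp add: left_diff_distrib)
    finally show ?thesis
      using zero_le_power2[of "norm (l *\<^sub>R e + v)"] by linarith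
  qed
  show "G * p + (norm (l *\<^sub>R e))\<^sup>2 / 2 - l * \<delta> / 4 * (norm e)\<^sup>2 \<le> (1 + sqrt 2 / 2) * G * p"
  proof -
    have "(norm (l *\<^sub>R e))\<^sup>2 / 2 - l * \<delta> / 4 * (norm e)\<^sup>2 = l * (l - \<delta> / 2) * ((norm e)\<^sup>2 / 2)"
      by (simp add: power_mult_distrib power2_eq_square[of l] field_simps)
    also have "\<dots> \<le> sqrt 2 / 2 * m * \<mu> * ((norm e)\<^sup>2 / 2)"
      by (rule mult_right_mono[OF rate_constants(2)[OF l rate]]) simp
    also have "\<dots> = sqrt 2 / 2 * m * (\<mu> / 2 * (norm e)\<^sup>2)"
      by simp
    also have "\<dots> \<le> sqrt 2 / 2 * G * p"
      by (rule mult_mono[OF mult_left_mono[OF \<open>G \<ge> m\<close>] growth]) (use assms(1-3) in simp_all)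
    finally show ?thesis
      by (simp add: distrib_right)
  qed
qed

text \<open>Translates the conditions on \<open>\<alpha>\<close> and \<open>\<gamma>\<close> into
  those on \<open>\<delta>\<close>, \<open>l\<close> and \<open>G\<close> used by the Lyapunov
  estimates, starting from \<alpha> = \<delta> (3 + \<open>sqrt 2\<close>) / 2.\<close>

lemma damping_parameters:
  assumes "m > 0" "\<mu> > 0" "\<beta> > 0"
    and \<alpha>: "\<alpha> \<in> {0 <.. (2 - sqrt 2 / 2) * sqrt (\<mu> * m)}"
    and \<gamma>: "\<gamma> = m * (1 + \<alpha> * \<beta> / (2 + 3 * sqrt 2)) + \<alpha> * \<beta> / (3 + sqrt 2)"
    and \<delta>: "\<delta> = 2 * \<alpha> / (3 + sqrt 2)"
  shows "\<delta> > 0"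
    and "\<delta> * (1 + sqrt 2 / 2) = \<alpha> - \<delta> / 2"
    and "\<gamma> - \<delta> * \<beta> / 2 \<ge> m"
    and "\<delta>\<^sup>2 \<le> (6 - 4 * sqrt 2) * (m * \<mu>)"
proof -
  have s: "sqrt 2 * sqrt 2 = 2" "sqrt 2 > 1" "sqrt 2 \<le> 2"
    by (simp_all add: real_less_rsqrt real_le_lsqrt)
  show "\<delta> > 0"
    using \<alpha> s by (simp add: \<delta> add_pos_pos)
  have \<alpha>_\<delta>: "\<alpha> = \<delta> * (3 + sqrt 2) / 2"
  proof -
    have "3 + sqrt 2 \<noteq> 0" using s(2) by linarith
    then show ?thesis by (simp add: \<delta>)
  qed
  show "\<delta> * (1 + sqrt 2 / 2) = \<alpha> - \<delta> / 2"
    by (simp add: \<alpha>_\<delta> field_simps)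
  \<comment> \<open>With \<open>r\<close> = \<open>\<alpha> / (3 + sqrt 2)\<close> this identifies
    \<open>\<delta> * \<beta> / 2\<close> with the last summand of \<open>\<gamma>\<close>, so the
    difference is \<open>m\<close> times a factor at least 1.\<close>
  have "2 * r * \<beta> / 2 = r * \<beta>" for r
    by simp
  moreover have "\<delta> = 2 * (\<alpha> / (3 + sqrt 2))"
    by (simp add: \<delta>)
  ultimately have "\<delta> * \<beta> / 2 = \<alpha> * \<beta> / (3 + sqrt 2)"
    by (simp only: times_divide_eq_left)
  then have "\<gamma> - \<delta> * \<beta> / 2 = m * (1 + \<alpha> * \<beta> / (2 + 3 * sqrt 2))"
    unfolding \<gamma> by linarith
  also have "\<dots> \<ge> m * 1"
    by (rule mult_left_mono) (use assms(1,3) \<alpha> s(2) in simp_all)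
  finally show "\<gamma> - \<delta> * \<beta> / 2 \<ge> m"
    by simp
  show "\<delta>\<^sup>2 \<le> (6 - 4 * sqrt 2) * (m * \<mu>)"
  proof -
    \<comment> \<open>(2 - \<open>sqrt 2\<close>)(3 + \<open>sqrt 2\<close>) = 4 -
      \<open>sqrt 2\<close> is twice the factor in the bound on \<open>\<alpha>\<close>, which
      therefore reads \<delta> \<le> (2 - \<open>sqrt 2\<close>)
      \<open>sqrt (m * \<mu>)\<close>.\<close>
    have "(2 - sqrt 2) * sqrt (m * \<mu>) * (3 + sqrt 2) = ((2 - sqrt 2) * (3 + sqrt 2)) * sqrt (\<mu> * m)"
      by (simp add: mult.commute)
    also have "(2 - sqrt 2) * (3 + sqrt 2) = 2 * (2 - sqrt 2 / 2)"
      using s(1) by (simp add: algebra_simps)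
    finally have "\<delta> * (3 + sqrt 2) \<le> (2 - sqrt 2) * sqrt (m * \<mu>) * (3 + sqrt 2)"
      using \<alpha> unfolding \<alpha>_\<delta> by (simp add: field_simps)
    then have "\<delta> \<le> (2 - sqrt 2) * sqrt (m * \<mu>)"
      by (rule mult_right_le_imp_le) (use s(2) in linarith)
    then have "\<delta>\<^sup>2 \<le> ((2 - sqrt 2) * sqrt (m * \<mu>))\<^sup>2"
      using \<open>\<delta> > 0\<close> by (intro power_mono) auto
    also have "\<dots> = (2 - sqrt 2)\<^sup>2 * (m * \<mu>)"
      using assms(1,2) by (simp add: power_mult_distrib)
    finally show ?thesis
      by (simp add: power2_diff)
  qed
qed

section \<open>The trajectory\<close>

text \<open>For a single minimizer \<open>infdist\<close> is the distance to that point, and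
  attainment gives the \<open>LEAST\<close> in \<open>min_value\<close> its meaning.\<close>

lemma unique_minimizer_quadratic_growth:
  assumes "\<exists>!z. z \<in> minimizers f" and "quadratic_growth f \<mu>"
  obtains z where "min_value f = f z"
    and "\<And>y. f z \<le> f y"
    and "\<And>y. \<mu> / 2 * (norm (y - z))\<^sup>2 \<le> f y - f z"
proof -
  obtain z where z: "minimizers f = {z}"
    using assms(1) by auto
  then have "is_arg_min f (\<lambda>_. True) z"
    unfolding minimizers_def by blast
  then have f_z: "f z \<le> f y" for y
    by (simp add: is_arg_min_linorder)
  have min_f: "min_value f = f z"
    unfolding min_value_def by (rule Least_equality) (use f_z in auto)
  have "\<mu> / 2 * (norm (y - z))\<^sup>2 \<le> f y - f z" for y
    using assms(2) unfolding quadratic_growth_def z min_f by (simp add: dist_norm)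
  with min_f f_z show thesis
    by (rule that)
qed

theorem theorem5:
  fixes f :: "'a::{real_inner, complete_space} \<Rightarrow> real"
    and x x' x'' :: "real \<Rightarrow> 'a"
    and x0 v0 :: 'a
    and \<mu> m \<alpha> \<beta> \<gamma> :: real
  assumes "convex_on UNIV f"
    and "twice_differentiable f"
    and "\<mu> > 0"
    and "quadratic_growth f \<mu>"
    and "\<exists>!z. z \<in> minimizers f"
    and "m \<ge> 1 / 2"
    and "\<alpha> \<in> {0 <.. (2 - sqrt 2 / 2) * sqrt (\<mu> * m)}"
    and "\<beta> > 0"
    and "\<gamma> = m * (1 + \<alpha> * \<beta> / (2 + 3 * sqrt 2)) + \<alpha> * \<beta> / (3 + sqrt 2)"
    and "\<And>t. t \<ge> 0 \<Longrightarrow> (x has_vector_derivative x' t) (at t within {0..})"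
    and "\<And>t. t \<ge> 0 \<Longrightarrow> (x' has_vector_derivative x'' t) (at t within {0..})"
    and "\<And>t. t \<ge> 0 \<Longrightarrow>
          x'' t + \<alpha> *\<^sub>R x' t + \<beta> *\<^sub>R hessian f (x t) (x' t) + \<gamma> *\<^sub>R gradient f (x t) = 0"
    and "x 0 = x0"
    and "x' 0 = v0"
    and "v0 = - (\<beta> *\<^sub>R gradient f x0)"
  shows "(\<forall>t\<ge>0. f (x t) - min_value f
            \<le> (1 + sqrt 2) * (f x0 - min_value f) * exp (- (2 / (3 + sqrt 2) * \<alpha> * t))) \<and>
         set_integrable lborel {0..}
            (\<lambda>t. exp (2 * \<alpha> / (3 + sqrt 2) * t) * (norm (gradient f (x t)))\<^sup>2)"
proof -
  let ?g = "\<lambda>t. gradient f (x t)"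
  have gderiv: "GDERIV f y :> gradient f y" for y
    using assms(2) by (intro gderiv_gradient) (simp add: twice_differentiable_def)
  have hess: "(gradient f has_derivative hessian f y) (at y)" for y
    using assms(2) by (simp add: twice_differentiable_def hessian_def frechet_derivative_works)
  obtain z where min_f: "min_value f = f z" and f_z: "\<And>y. f z \<le> f y"
    and growth: "\<And>y. \<mu> / 2 * (norm (y - z))\<^sup>2 \<le> f y - f z"
    using unique_minimizer_quadratic_growth[OF assms(5,4)] by blast
  have tangent: "f y - f z \<le> (y - z) \<bullet> gradient f y" for y
    using convex_on_gradient_le[OF assms(1) gderiv[of y], of z] by (simp add: inner_diff_left)
  have m: "m > 0"
    using assms(6) by simp
  define \<delta> where "\<delta> = 2 * \<alpha> / (3 + sqrt 2)"
  define l where "l = \<delta> * (1 + sqrt 2 / 2)"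
  define G where "G = \<gamma> - \<delta> * \<beta> / 2"
  note params = damping_parameters[OF m assms(3,8,7,9) \<delta>_def]
  note \<delta> = params(1) and l_\<alpha> = params(2)[folded l_def] and G_m = params(3)[folded G_def]
    and rate = params(4)
  define v where "v = (\<lambda>t. x' t + \<beta> *\<^sub>R ?g t)"
  define E where "E = (\<lambda>t. G * (f (x t) - f z) + (norm (l *\<^sub>R (x t - z) + v t))\<^sup>2 / 2
               - l * \<delta> / 4 * (norm (x t - z))\<^sup>2)"
  define h where "h = (\<lambda>t. (sqrt 2 - 1) * m * \<beta> * (norm (?g t))\<^sup>2)"
  have x': "x' t = v t - \<beta> *\<^sub>R ?g t" for t
    by (simp add: v_def)
  have deriv_g: "(?g has_vector_derivative hessian f (x t) (x' t)) (at t within {0..})"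
    if "t \<ge> 0" for t
    using vector_derivative_diff_chain_within[OF assms(10)[OF that] has_derivative_at_withinI[OF hess]]
    by (simp add: o_def)
  have cont: "continuous_on {0..} h"
    unfolding h_def
    by (intro continuous_intros continuous_on_vector_derivative) (use deriv_g in auto)
  have deriv_v: "(v has_vector_derivative (\<alpha> * \<beta> - \<gamma>) *\<^sub>R ?g t - \<alpha> *\<^sub>R v t) (at t within {0..})"
    if "t \<ge> 0" for t
  proof -
    have "(v has_vector_derivative x'' t + \<beta> *\<^sub>R hessian f (x t) (x' t)) (at t within {0..})"
      unfolding v_def using assms(11)[OF that] deriv_g[OF that]
      by (auto intro!: derivative_eq_intros)
    \<comment> \<open>The equation of motion turns the left side into -\<alpha> x' - \<gamma> g, and
      x' = v - \<beta> g does the rest.\<close>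
    moreover have "x'' t + \<beta> *\<^sub>R hessian f (x t) (x' t) = (\<alpha> * \<beta> - \<gamma>) *\<^sub>R ?g t - \<alpha> *\<^sub>R v t"
      using assms(12)[OF that] by (simp add: v_def algebra_simps add_eq_0_iff2)
    ultimately show ?thesis by simp
  qed
  have decay: "exp (\<delta> * T) * E T + integral {0..T} (\<lambda>t. exp (\<delta> * t) * h t) \<le> E 0"
    if "T \<ge> 0" for T
  proof (rule exp_weighted_decay[OF _ _ cont that])
    fix t :: real assume t: "t \<ge> 0"
    have "((\<lambda>t. f (x t) - f z) has_real_derivative (v t - \<beta> *\<^sub>R ?g t) \<bullet> ?g t) (at t within {0..})"
      using DERIV_diff[OF has_real_derivative_gderiv_comp[OF gderiv assms(10)[OF t]] DERIV_const]
      by (simp only: x' diff_0_right)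
    with assms(10)[OF t] deriv_v[OF t] show "(E has_real_derivative
      (\<delta> * G * (f (x t) - f z) - l * (G - \<delta> * \<beta> / 2) * ((x t - z) \<bullet> ?g t)
        + \<delta> * l * (l - \<delta> / 2) / 2 * (norm (x t - z))\<^sup>2 - G * \<beta> * (norm (?g t))\<^sup>2) - \<delta> * E t)
      (at t within {0..})"
      unfolding x' by (intro lyapunov_has_derivative[OF _ _ _ l_\<alpha> G_def E_def])
    show "\<delta> * G * (f (x t) - f z) - l * (G - \<delta> * \<beta> / 2) * ((x t - z) \<bullet> ?g t)
        + \<delta> * l * (l - \<delta> / 2) / 2 * (norm (x t - z))\<^sup>2 - G * \<beta> * (norm (?g t))\<^sup>2 \<le> - h t"
      unfolding h_def
      by (rule lyapunov_dissipation[OF \<open>\<mu> > 0\<close> \<open>\<beta> > 0\<close> \<delta> m G_m l_def rate tangent growth])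
  qed
  note bounds = lyapunov_bounds[OF \<open>\<mu> > 0\<close> m G_m l_def rate growth]
  have lower: "sqrt 2 / 2 * G * (f (x t) - f z) \<le> E t" for t
    unfolding E_def by (rule bounds(1))
  \<comment> \<open>The prescribed initial velocity enters here, making the upper bound with v = 0
    applicable.\<close>
  have "v 0 = 0"
    using assms(13,14,15) by (simp add: v_def)
  then have "E 0 \<le> (1 + sqrt 2 / 2) * G * (f (x 0) - f z)"
    unfolding E_def using bounds(2)[of "x 0"] by simp
  \<comment> \<open>Pulls out the constant \<open>sqrt 2 / 2\<close> of the lower bound; the factor
    left over is the one in the claimed estimate.\<close>
  also have "1 + sqrt 2 / 2 = sqrt 2 / 2 * (1 + sqrt 2)"
    by (simp add: algebra_simps)
  finally have upper: "E 0 \<le> sqrt 2 / 2 * G * ((1 + sqrt 2) * (f (x 0) - f z))"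
    by (simp only: mult_ac)
  have "h t \<ge> 0" "sqrt 2 / 2 * G > 0" "f (x t) - f z \<ge> 0" for t
    using m G_m \<open>\<beta> > 0\<close> f_z[of "x t"] by (simp_all add: h_def)
  note concl = exp_decay_of_weighted_bound[OF decay cont this lower upper]
  \<comment> \<open>The constant in \<open>h\<close> is nonzero, so it can be removed from the
    integrability statement.\<close>
  have "(\<lambda>t. exp (\<delta> * t) * h t)
      = (\<lambda>t. ((sqrt 2 - 1) * m * \<beta>) * (exp (\<delta> * t) * (norm (?g t))\<^sup>2))"
    by (simp add: h_def mult_ac)
  with concl(2) have "set_integrable lborel {0..} (\<lambda>t. exp (\<delta> * t) * (norm (?g t))\<^sup>2)"
    using m \<open>\<beta> > 0\<close> by simp
  then show ?thesis
    using concl(1) by (simp add: min_f \<delta>_def assms(13))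
qed

end
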